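(* Let $p$ and $q$ be two probability densities and, for $(l,s)\in\mathbb{H}=\mathbb{R}\times(0,\infty)$, let $p_{l,s}(x)=\frac{1}{s}p\left(\frac{x-l}{s}\right)$ and $q_{l,s}(x)=\frac{1}{s}q\left(\frac{x-l}{s}\right)$; let $P=\{p_{l,s}:(l,s)\in\mathbb{H}\}$ and $Q=\{q_{l,s}:(l,s)\in\mathbb{H}\}$ be the associated location-scale families, assumed to share the same support $\mathcal{X}$. Let $f$ be a convex function on $(0,\infty)$, strictly convex at $1$, with $f(1)=0$. Assume that the minima below are attained. (1) For $(l_1,s_1)\in\mathbb{H}$, let $(l_1^*,s_1^* )\in\mathbb{H}$ be a minimizer of $(l,s)\mapsto I_f(p_{l_1,s_1}:q_{l,s})$ over $\mathbb{H}$. Then the value $I_f(p_{l_1,s_1}:q_{l_1^*,s_1^*})=\min_{(l,s)\in\mathbb{H}}I_f(p_{l_1,s_1}:q_{l,s})$ is independent of $(l_1,s_1)$. (2) For $(l_2,s_2)\in\mathbb{H}$, let $(l_2^*,s_2^* )\in\mathbb{H}$ be a minimizer of $(l,s)\mapsto I_f(p_{l,s}:q_{l_2,s_2})$ over $\mathbb{H}$. Then the value $I_f(p_{l_2^*,s_2^*}:q_{l_2,s_2})=\min_{(l,s)\in\mathbb{H}}I_f(p_{l,s}:q_{l_2,s_2})$ is independent of $(l_2,s_2)$.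
   Context: All densities are probability densities with respect to Lebesgue measure on $\mathbb{R}$. A density has support $\mathcal{X}\subseteq\mathbb{R}$ if it is positive on $\mathcal{X}$ and zero outside; the two families share the same support $\mathcal{X}$ means that all their members have support $\mathcal{X}$. For two densities $p,q$ with support $\mathcal{X}$, the $f$-divergence is $I_f(p:q)=\int_{\mathcal{X}}p(x)\,f\left(\frac{q(x)}{p(x)}\right)dx\in[0,+\infty]$. *)

theory Defs
  imports "HOL-Analysis.Analysis"
begin

definition prob_density :: "(real \<Rightarrow> real) \<Rightarrow> bool" where
  "prob_density p \<longleftrightarrow>
     p \<in> borel_measurable lborel \<and> (\<forall>x. 0 \<le> p x) \<and> (\<integral>\<^sup>+x. ennreal (p x) \<partial>lborel) = 1"

text \<open>The support is pointwise (the set where the density is positive), not its topological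
  closure.\<close>

definition has_support :: "(real \<Rightarrow> real) \<Rightarrow> real set \<Rightarrow> bool" where
  "has_support p X \<longleftrightarrow> (\<forall>x\<in>X. 0 < p x) \<and> (\<forall>x. x \<notin> X \<longrightarrow> p x = 0)"

definition loc_scale_params :: "(real \<times> real) set" where
  "loc_scale_params = UNIV \<times> {0<..}"

definition loc_scale :: "(real \<Rightarrow> real) \<Rightarrow> real \<times> real \<Rightarrow> real \<Rightarrow> real" where
  "loc_scale p = (\<lambda>(l, s) x. 1 / s * p ((x - l) / s))"

definition strictly_convex_at :: "(real \<Rightarrow> real) \<Rightarrow> real set \<Rightarrow> real \<Rightarrow> bool" where
  "strictly_convex_at f A c \<longleftrightarrow>
     (\<forall>a\<in>A. \<forall>b\<in>A. \<forall>t. 0 < t \<and> t < 1 \<and> a \<noteq> b \<and> (1 - t) * a + t * b = c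
        \<longrightarrow> f c < (1 - t) * f a + t * f b)"

text \<open>The integral of a real function with values in the extended reals, as positive part minus
  negative part. For convex \<open>f\<close> and densities \<open>p\<close>, \<open>q\<close> with support \<open>X\<close> the negative part is finite:
  a supporting line at 1 gives \<open>f t \<ge> f 1 + c * (t - 1)\<close>, so \<open>p * f (q / p)\<close> is bounded below by
  the integrable function \<open>f 1 * p + c * (q - p)\<close> on \<open>X\<close>. The difference is thus never of the form
  \<open>\<infinity> - \<infinity>\<close>.\<close>

definition f_divergence ::
    "(real \<Rightarrow> real) \<Rightarrow> real set \<Rightarrow> (real \<Rightarrow> real) \<Rightarrow> (real \<Rightarrow> real) \<Rightarrow> ereal" where
  "f_divergence f X p q =
     enn2ereal (\<integral>\<^sup>+x\<in>X. ennreal (p x * f (q x / p x)) \<partial>lborel)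
   - enn2ereal (\<integral>\<^sup>+x\<in>X. ennreal (- (p x * f (q x / p x))) \<partial>lborel)"

end

theory Submission
  imports Defs
begin

text \<open>The parameters of a location-scale family form a group, that of the affine maps
  \<open>x \<mapsto> l + s x\<close> with \<open>s > 0\<close>, and this group acts on densities by pushing them forward. The
  substitution \<open>x = l + s y\<close> shows that an \<open>f\<close>-divergence does not change when the same affine map
  acts on both of its arguments (\<open>f_divergence_loc_scale\<close>): the factor \<open>1 / s\<close> cancels in the
  quotient of the densities, and the one that remains in front cancels against \<open>dx = s dy\<close>.

  Hence the divergence between \<open>p\<close> moved by \<open>g\<close> and \<open>q\<close> moved by \<open>h\<close> equals the divergence between
  \<open>p\<close> and \<open>q\<close> moved by the inverse of \<open>g\<close> times \<open>h\<close>. When \<open>h\<close> runs through the whole group, so does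
  this product, so the set of divergences over which one minimizes is the same for every \<open>g\<close>, and
  so is its infimum (\<open>INF_invariant_loc_scale\<close>). Exchanging the roles of the two families gives the
  other half. Convexity makes \<open>f\<close> continuous on the positive half line, so that the integrands are
  measurable and the substitution applies.\<close>

definition affine_mult :: "real \<times> real \<Rightarrow> real \<times> real \<Rightarrow> real \<times> real" where
  "affine_mult = (\<lambda>(l, s) (a, b). (l + s * a, s * b))"

lemma loc_scale_unit [simp]: "loc_scale p (0, 1) = p"
  by (simp add: loc_scale_def)

lemma loc_scale_affine_mult:
  assumes "g \<in> loc_scale_params"
  shows "loc_scale p (affine_mult g \<theta>) = loc_scale (loc_scale p \<theta>) g"
proof -
  obtain l s where g: "g = (l, s)" by fastforce
  with assms have s: "s > 0" by (simp add: loc_scale_params_def)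
  obtain a b where \<theta>: "\<theta> = (a, b)" by fastforce
  have "(x - (l + s * a)) / (s * b) = ((x - l) / s - a) / b" for x
    using s by (simp add: divide_simps)
  then show ?thesis
    unfolding g \<theta> by (simp add: loc_scale_def affine_mult_def fun_eq_iff)
qed

lemma affine_mult_unit_right: "affine_mult g (0, 1) = g"
  by (cases g) (simp add: affine_mult_def)

lemma affine_mult_image:
  assumes "g \<in> loc_scale_params"
  shows "affine_mult g ` loc_scale_params = loc_scale_params"
proof
  obtain l s where g: "g = (l, s)" and s: "s > 0"
    using assms by (auto simp: loc_scale_params_def)
  show "affine_mult g ` loc_scale_params \<subseteq> loc_scale_params"
    using s by (auto simp: g affine_mult_def loc_scale_params_def)
  show "loc_scale_params \<subseteq> affine_mult g ` loc_scale_params"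
  proof
    fix h assume h: "h \<in> loc_scale_params"
    obtain a b where ab: "h = (a, b)" "b > 0"
      using h by (auto simp: loc_scale_params_def)
    have "h = affine_mult g ((a - l) / s, b / s)" "((a - l) / s, b / s) \<in> loc_scale_params"
      using s ab by (simp_all add: g affine_mult_def loc_scale_params_def)
    then show "h \<in> affine_mult g ` loc_scale_params" by blast
  qed
qed

text \<open>The member with parameter \<open>(l, s)\<close> has the image of the support of \<open>p\<close> under the affine map
  as its support. If all members share one support, the group therefore maps it to itself, and the
  domain of integration is preserved by the change of variables.\<close>

lemma common_support_affine_invariant:
  assumes "\<forall>\<theta>\<in>loc_scale_params. has_support (loc_scale p \<theta>) X" and "s > 0"
  shows "(x - l) / s \<in> X \<longleftrightarrow> x \<in> X"
proof -
  have "has_support p X"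
    using assms(1)[rule_format, of "(0, 1)"] by (simp add: loc_scale_params_def)
  then have 1: "p ((x - l) / s) > 0 \<longleftrightarrow> (x - l) / s \<in> X"
    unfolding has_support_def by (metis less_irrefl)
  have "has_support (loc_scale p (l, s)) X"
    using assms by (simp add: loc_scale_params_def)
  then have "loc_scale p (l, s) x > 0 \<longleftrightarrow> x \<in> X"
    unfolding has_support_def by (metis less_irrefl)
  with 1 assms(2) show ?thesis by (simp add: loc_scale_def zero_less_divide_iff)
qed

lemma has_support_imp_borel:
  assumes "p \<in> borel_measurable lborel" and "has_support p X"
  shows "X \<in> sets borel"
proof -
  have "X = {x. 0 < p x}"
    using assms(2) unfolding has_support_def by fastforce
  with assms(1) show ?thesis by simp
qed

text \<open>Outside the positive half line \<open>f\<close> may fail to be measurable. This does no harm, since on the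
  support the quotient \<open>q / p\<close> is positive, and there \<open>f\<close> is continuous.\<close>

lemma borel_measurable_divergence_integrand:
  assumes p: "p \<in> borel_measurable lborel" "has_support p X"
    and q: "q \<in> borel_measurable lborel" "has_support q X"
    and f: "convex_on {0<..} f"
  shows "(\<lambda>x. indicator X x * (p x * f (q x / p x))) \<in> borel_measurable borel"
proof -
  have [measurable]: "p \<in> borel_measurable borel" "q \<in> borel_measurable borel"
    using p q by simp_all
  have [measurable]: "X \<in> sets borel"
    using has_support_imp_borel[OF p] .
  have "continuous_on {0<..} f"
    using convex_on_continuous[OF _ f] by simp
  then have [measurable]: "(\<lambda>x. indicator {0<..} x *\<^sub>R f x) \<in> borel_measurable borel"
    by (intro borel_measurable_continuous_on_indicator) simp_all
  have "(\<lambda>x. indicator X x * (p x * (indicator {0<..} (q x / p x) *\<^sub>R f (q x / p x))))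
      \<in> borel_measurable borel"
    by measurable
  moreover have "indicator X x * (p x * (indicator {0<..} (q x / p x) *\<^sub>R f (q x / p x)))
      = indicator X x * (p x * f (q x / p x))" for x
    using p(2) q(2) by (auto simp: has_support_def indicator_def)
  ultimately show ?thesis by (simp only:)
qed

lemma nn_integral_loc_scale:
  fixes h :: "real \<Rightarrow> real"
  assumes [measurable]: "h \<in> borel_measurable borel" and "s > 0"
  shows "(\<integral>\<^sup>+x. ennreal (loc_scale h (l, s) x) \<partial>lborel) = (\<integral>\<^sup>+x. ennreal (h x) \<partial>lborel)"
proof -
  have "(\<integral>\<^sup>+x. ennreal (loc_scale h (l, s) x) \<partial>lborel)
      = ennreal s * (\<integral>\<^sup>+y. ennreal (1 / s * h y) \<partial>lborel)"
    using assms(2)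
    by (subst nn_integral_real_affine[where c = s and t = l]) (simp_all add: loc_scale_def)
  also have "\<dots> = (\<integral>\<^sup>+y. ennreal (h y) \<partial>lborel)"
    using assms(2)
    by (simp flip: nn_integral_cmult add: ennreal_mult'[symmetric])
  finally show ?thesis .
qed

lemma f_divergence_loc_scale:
  assumes p: "p \<in> borel_measurable lborel" "has_support p X"
    and q: "q \<in> borel_measurable lborel" "has_support q X"
    and f: "convex_on {0<..} f" and s: "s > 0"
  shows "f_divergence f {x. (x - l) / s \<in> X} (loc_scale p (l, s)) (loc_scale q (l, s))
    = f_divergence f X p q"
proof -
  define h where "h = (\<lambda>x. indicator X x * (p x * f (q x / p x)))"
  let ?Y = "{x. (x - l) / s \<in> X}" and ?p = "loc_scale p (l, s)" and ?q = "loc_scale q (l, s)"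
  have h [measurable]: "h \<in> borel_measurable borel"
    unfolding h_def by (rule borel_measurable_divergence_integrand[OF p q f])
  have pos: "ennreal (p x * f (q x / p x)) * indicator X x = ennreal (h x)"
    and neg: "ennreal (- (p x * f (q x / p x))) * indicator X x = ennreal (- h x)" for x
    by (simp_all add: h_def indicator_def)
  have pos': "ennreal (?p x * f (?q x / ?p x)) * indicator ?Y x = ennreal (loc_scale h (l, s) x)"
    and neg': "ennreal (- (?p x * f (?q x / ?p x))) * indicator ?Y x
      = ennreal (loc_scale (\<lambda>x. - h x) (l, s) x)" for x
    using s by (simp_all add: h_def loc_scale_def indicator_def)
  show ?thesis
    unfolding f_divergence_def pos neg pos' neg'
    using s by (simp add: nn_integral_loc_scale)
qed

text \<open>Both halves of the theorem are instances: \<open>D\<close> is the divergence between members of the two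
  families, as a function of the parameters in one order or the other.\<close>

lemma INF_invariant_loc_scale:
  fixes D :: "real \<times> real \<Rightarrow> real \<times> real \<Rightarrow> 'a :: complete_lattice"
  assumes inv: "\<And>g \<eta> \<theta>. g \<in> loc_scale_params \<Longrightarrow> \<eta> \<in> loc_scale_params \<Longrightarrow> \<theta> \<in> loc_scale_params
      \<Longrightarrow> D (affine_mult g \<eta>) (affine_mult g \<theta>) = D \<eta> \<theta>"
    and g: "g \<in> loc_scale_params"
  shows "(INF \<theta>\<in>loc_scale_params. D g \<theta>) = (INF \<theta>\<in>loc_scale_params. D (0, 1) \<theta>)"
proof -
  have unit: "(0, 1) \<in> loc_scale_params" by (simp add: loc_scale_params_def)
  have "(INF \<theta>\<in>loc_scale_params. D g \<theta>) = (INF \<theta>\<in>affine_mult g ` loc_scale_params. D g \<theta>)"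
    by (simp add: affine_mult_image[OF g])
  also have "\<dots> = (INF \<theta>\<in>loc_scale_params. D (affine_mult g (0, 1)) (affine_mult g \<theta>))"
    by (simp add: image_image affine_mult_unit_right)
  also have "\<dots> = (INF \<theta>\<in>loc_scale_params. D (0, 1) \<theta>)"
    by (intro INF_cong refl inv g unit)
  finally show ?thesis .
qed

lemma is_arg_min_eq_INF:
  fixes F :: "'b \<Rightarrow> 'a :: complete_linorder"
  assumes "is_arg_min F (\<lambda>\<theta>. \<theta> \<in> A) \<theta>"
  shows "F \<theta> = (INF \<theta>\<in>A. F \<theta>)"
  using assms by (intro antisym INF_greatest INF_lower) (auto simp: is_arg_min_linorder)

theorem theorem5:
  fixes p q f :: "real \<Rightarrow> real" and X :: "real set"
  assumes "prob_density p" and "prob_density q"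
    and "\<forall>\<theta>\<in>loc_scale_params. has_support (loc_scale p \<theta>) X"
    and "\<forall>\<theta>\<in>loc_scale_params. has_support (loc_scale q \<theta>) X"
    and "convex_on {0<..} f" and "strictly_convex_at f {0<..} 1" and "f 1 = 0"
  shows
    "((\<forall>\<theta>1\<in>loc_scale_params. \<exists>\<theta>. is_arg_min
         (\<lambda>\<theta>. f_divergence f X (loc_scale p \<theta>1) (loc_scale q \<theta>)) (\<lambda>\<theta>. \<theta> \<in> loc_scale_params) \<theta>)
     \<longrightarrow> (\<exists>m. \<forall>\<theta>1\<in>loc_scale_params. \<forall>\<theta>1'. is_arg_min
            (\<lambda>\<theta>. f_divergence f X (loc_scale p \<theta>1) (loc_scale q \<theta>)) (\<lambda>\<theta>. \<theta> \<in> loc_scale_params) \<theta>1'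
          \<longrightarrow> f_divergence f X (loc_scale p \<theta>1) (loc_scale q \<theta>1') = m
            \<and> (INF \<theta>\<in>loc_scale_params. f_divergence f X (loc_scale p \<theta>1) (loc_scale q \<theta>)) = m))
   \<and>
    ((\<forall>\<theta>2\<in>loc_scale_params. \<exists>\<theta>. is_arg_min
         (\<lambda>\<theta>. f_divergence f X (loc_scale p \<theta>) (loc_scale q \<theta>2)) (\<lambda>\<theta>. \<theta> \<in> loc_scale_params) \<theta>)
     \<longrightarrow> (\<exists>m. \<forall>\<theta>2\<in>loc_scale_params. \<forall>\<theta>2'. is_arg_min
            (\<lambda>\<theta>. f_divergence f X (loc_scale p \<theta>) (loc_scale q \<theta>2)) (\<lambda>\<theta>. \<theta> \<in> loc_scale_params) \<theta>2'
          \<longrightarrow> f_divergence f X (loc_scale p \<theta>2') (loc_scale q \<theta>2) = m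
            \<and> (INF \<theta>\<in>loc_scale_params. f_divergence f X (loc_scale p \<theta>) (loc_scale q \<theta>2)) = m))"
proof -
  define D where
    "D = (\<lambda>\<eta> \<theta>. f_divergence f X (loc_scale p \<eta>) (loc_scale q \<theta>))"
  have meas: "loc_scale r \<theta> \<in> borel_measurable lborel"
    if "prob_density r" for r \<theta>
  proof -
    have [measurable]: "r \<in> borel_measurable borel"
      using that by (simp add: prob_density_def)
    show ?thesis by (cases \<theta>) (simp add: loc_scale_def)
  qed
  have inv: "D (affine_mult g \<eta>) (affine_mult g \<theta>) = D \<eta> \<theta>"
    if g: "g \<in> loc_scale_params" and \<eta>: "\<eta> \<in> loc_scale_params" and \<theta>: "\<theta> \<in> loc_scale_params"
    for g \<eta> \<theta>
  proof -
    obtain l s where ls: "g = (l, s)" "s > 0"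
      using g by (auto simp: loc_scale_params_def)
    have "{x. (x - l) / s \<in> X} = X"
      using common_support_affine_invariant[OF assms(3) ls(2)] by simp
    moreover have "has_support (loc_scale p \<eta>) X" "has_support (loc_scale q \<theta>) X"
      using assms(3,4) \<eta> \<theta> by blast+
    note f_divergence_loc_scale[OF meas[OF assms(1)] this(1) meas[OF assms(2)] this(2)
        assms(5) ls(2), of l]
    ultimately show ?thesis
      using g
      by (simp add: D_def loc_scale_affine_mult ls(1))
  qed
  have fst: "D \<theta>1 \<theta>1' = (INF \<theta>\<in>loc_scale_params. D (0, 1) \<theta>)
      \<and> (INF \<theta>\<in>loc_scale_params. D \<theta>1 \<theta>) = (INF \<theta>\<in>loc_scale_params. D (0, 1) \<theta>)"
    if \<theta>1: "\<theta>1 \<in> loc_scale_params"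
      and min: "is_arg_min (\<lambda>\<theta>. D \<theta>1 \<theta>) (\<lambda>\<theta>. \<theta> \<in> loc_scale_params) \<theta>1'" for \<theta>1 \<theta>1'
    using is_arg_min_eq_INF[OF min] INF_invariant_loc_scale[where D = D, OF inv \<theta>1]
    by (simp only:)
  have snd: "D \<theta>2' \<theta>2 = (INF \<theta>\<in>loc_scale_params. D \<theta> (0, 1))
      \<and> (INF \<theta>\<in>loc_scale_params. D \<theta> \<theta>2) = (INF \<theta>\<in>loc_scale_params. D \<theta> (0, 1))"
    if \<theta>2: "\<theta>2 \<in> loc_scale_params"
      and min: "is_arg_min (\<lambda>\<theta>. D \<theta> \<theta>2) (\<lambda>\<theta>. \<theta> \<in> loc_scale_params) \<theta>2'" for \<theta>2 \<theta>2'
  proof -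
    have "(INF \<theta>\<in>loc_scale_params. D \<theta> \<theta>2) = (INF \<theta>\<in>loc_scale_params. D \<theta> (0, 1))"
      by (rule INF_invariant_loc_scale[where D = "\<lambda>\<eta> \<theta>. D \<theta> \<eta>", OF _ \<theta>2])
        (rule inv)
    with is_arg_min_eq_INF[OF min] show ?thesis by (simp only:)
  qed
  show ?thesis
    using fst snd unfolding D_def by blast
qed

end
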